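(* Let $\mu>0$, $\theta>0$, $\alpha<-2$ be real numbers, let $d(p)=\mu\,\dfrac{e^{-(\alpha+\theta p)}}{1+e^{-(\alpha+\theta p)}}$ be the logit demand function, and let $R(p)=p\,d(p)$ be the corresponding revenue function, for prices $p\ge 0$. Then there exists a price $p^*>0$ such that: (i) $R$ attains its global maximum over $[0,\infty)$ at $p^*$; (ii) $R'(p)>0$ for all $0\le p<p^*$ and $R'(p)<0$ for all $p>p^*$; (iii) consequently, $R$ is strictly increasing on $(0,p^* )$, strictly decreasing on $(p^*,\infty)$, and unimodal.
   Context: The feasible price domain is $p\ge 0$; $d$ and $R$ are given by formulas smooth on all of $\mathbb{R}$, and $R'$ denotes the derivative of $R$ with respect to $p$. "Unimodal" means that there is a single price before which $R$ is strictly increasing and after which $R$ is strictly decreasing, so that $R$ has exactly one global maximizer. *)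

theory Defs
  imports "HOL-Analysis.Analysis"
begin

definition logit_demand :: "real \<Rightarrow> real \<Rightarrow> real \<Rightarrow> real \<Rightarrow> real" where
  "logit_demand \<mu> \<theta> \<alpha> p = \<mu> * (exp (- (\<alpha> + \<theta> * p)) / (1 + exp (- (\<alpha> + \<theta> * p))))"

definition revenue :: "real \<Rightarrow> real \<Rightarrow> real \<Rightarrow> real \<Rightarrow> real" where
  "revenue \<mu> \<theta> \<alpha> p = p * logit_demand \<mu> \<theta> \<alpha> p"

definition global_max_on :: "real set \<Rightarrow> (real \<Rightarrow> real) \<Rightarrow> real \<Rightarrow> bool" where
  "global_max_on S f m \<longleftrightarrow> m \<in> S \<and> (\<forall>x\<in>S. f x \<le> f m)"

text \<open>
  The turning point belongs to both monotone pieces; for discontinuous functions this is what makes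
  it the maximizer. The second conjunct then follows from the first, and is kept because having
  exactly one global maximizer is part of what the term is meant to convey.
\<close>

definition unimodal_on :: "real set \<Rightarrow> (real \<Rightarrow> real) \<Rightarrow> bool" where
  "unimodal_on S f \<longleftrightarrow>
     (\<exists>!m. m \<in> S \<and> strict_mono_on (S \<inter> {..m}) f \<and> strict_antimono_on (S \<inter> {m..}) f) \<and>
     (\<exists>!m. global_max_on S f m)"

end

theory Submission
  imports Defs
begin

text \<open>
  With \<open>E = exp (- (\<alpha> + \<theta> p))\<close>, the derivative of the revenue is \<open>\<mu> E / (1 + E)\<^sup>2\<close> times the
  strictly decreasing function \<open>1 + E - \<theta> p\<close>. The latter is positive at \<open>0\<close> and negative at
  \<open>(1 + exp (- \<alpha>)) / \<theta>\<close>; its unique zero is the optimal price.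
\<close>

text \<open>Since \<open>m\<close> lies in both pieces, any other point shares a piece with
  \<open>m\<close> and is compared with it directly; neither continuity nor connectedness of
  \<open>S\<close> enters.\<close>

lemma strict_max_at_turning_point:
  fixes f :: "real \<Rightarrow> real"
  assumes "m \<in> S" "strict_mono_on (S \<inter> {..m}) f" "strict_antimono_on (S \<inter> {m..}) f"
    and "x \<in> S" "x \<noteq> m"
  shows "f x < f m"
proof (cases "x < m")
  case True
  then show ?thesis using assms by (intro strict_mono_onD[OF assms(2)]) auto
next
  case False
  then show ?thesis using assms by (intro monotone_onD[OF assms(3)]) auto
qed

lemma global_max_on_turning_point:
  assumes "m \<in> S" "strict_mono_on (S \<inter> {..m}) f" "strict_antimono_on (S \<inter> {m..}) f"
  shows "global_max_on S f m"
proof -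
  have "f x \<le> f m" if "x \<in> S" for x
    using strict_max_at_turning_point[OF assms that] by (cases "x = m") auto
  then show ?thesis
    using assms(1) by (simp add: global_max_on_def)
qed

text \<open>Both uniqueness claims rest on one fact: a global maximizer must equal \<open>m\<close>,
  because every other point has a strictly smaller value. A second turning point would itself be a
  global maximizer, hence also \<open>m\<close>.\<close>

lemma unimodal_on_turning_point:
  assumes "m \<in> S" "strict_mono_on (S \<inter> {..m}) f" "strict_antimono_on (S \<inter> {m..}) f"
  shows "unimodal_on S f"
proof -
  have unique: "m' = m" if "global_max_on S f m'" for m'
    using that strict_max_at_turning_point[OF assms, of m'] assms(1)
    unfolding global_max_on_def by force
  have ex_max: "\<exists>!m. global_max_on S f m"
    using global_max_on_turning_point[OF assms] unique by (rule ex1I)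
  have "\<exists>!m. m \<in> S \<and> strict_mono_on (S \<inter> {..m}) f \<and> strict_antimono_on (S \<inter> {m..}) f"
  proof (rule ex1I[of _ m])
    show "m' = m"
      if "m' \<in> S \<and> strict_mono_on (S \<inter> {..m'}) f \<and> strict_antimono_on (S \<inter> {m'..}) f" for m'
      using that by (intro unique global_max_on_turning_point) simp_all
  qed (use assms in simp)
  then show ?thesis
    unfolding unimodal_on_def using ex_max by simp
qed

lemma revenue_has_derivative:
  "(revenue \<mu> \<theta> \<alpha> has_real_derivative
     \<mu> * exp (- (\<alpha> + \<theta> * p)) / (1 + exp (- (\<alpha> + \<theta> * p)))\<^sup>2 *
     (1 + exp (- (\<alpha> + \<theta> * p)) - \<theta> * p)) (at p)"
proof -
  define E where "E p = exp (- (\<alpha> + \<theta> * p))" for p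
  have dE: "(E has_real_derivative - \<theta> * E p) (at p)"
    unfolding E_def by (auto intro!: derivative_eq_intros)
  have "E p > 0"
    by (simp add: E_def)
  then have nz: "1 + E p \<noteq> 0"
    by simp
  have "((\<lambda>p. p * (\<mu> * (E p / (1 + E p)))) has_real_derivative
      1 * (\<mu> * (E p / (1 + E p))) +
      \<mu> * ((- \<theta> * E p * (1 + E p) - E p * (- \<theta> * E p)) / ((1 + E p) * (1 + E p))) * p) (at p)"
    using nz dE by (intro DERIV_mult DERIV_cmult DERIV_divide DERIV_ident)
      (auto intro!: derivative_eq_intros)
  \<comment> \<open>The quadratic terms of the quotient rule cancel, leaving
    \<open>- \<theta> * E p\<close> as its numerator; then
    \<open>\<mu> * E p / (1 + E p)\<^sup>2\<close> factors out of the sum.\<close>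
  also have "1 * (\<mu> * (E p / (1 + E p))) +
      \<mu> * ((- \<theta> * E p * (1 + E p) - E p * (- \<theta> * E p)) / ((1 + E p) * (1 + E p))) * p =
      \<mu> * E p / (1 + E p)\<^sup>2 * (1 + E p - \<theta> * p)"
    using nz by (simp add: divide_simps power2_eq_square) (simp add: algebra_simps)
  finally show ?thesis
    unfolding revenue_def[abs_def] logit_demand_def E_def .
qed

lemma deriv_revenue:
  "deriv (revenue \<mu> \<theta> \<alpha>) p =
     \<mu> * exp (- (\<alpha> + \<theta> * p)) / (1 + exp (- (\<alpha> + \<theta> * p)))\<^sup>2 *
     (1 + exp (- (\<alpha> + \<theta> * p)) - \<theta> * p)"
  by (rule DERIV_imp_deriv[OF revenue_has_derivative])

lemma revenue_has_deriv:
  "(revenue \<mu> \<theta> \<alpha> has_real_derivative deriv (revenue \<mu> \<theta> \<alpha>) p) (at p)"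
  unfolding deriv_revenue by (rule revenue_has_derivative)

text \<open>The first factor of the derivative is positive. Equating \<open>sgn\<close> values lets
  one lemma serve both sides of the turning point.\<close>

lemma sgn_deriv_revenue:
  assumes "\<mu> > 0"
  shows "sgn (deriv (revenue \<mu> \<theta> \<alpha>) p) = sgn (1 + exp (- (\<alpha> + \<theta> * p)) - \<theta> * p)"
proof -
  have "1 + exp (- (\<alpha> + \<theta> * p)) > 0"
    by (smt (verit) exp_gt_zero)
  then have "\<mu> * exp (- (\<alpha> + \<theta> * p)) / (1 + exp (- (\<alpha> + \<theta> * p)))\<^sup>2 > 0"
    using assms by simp
  then show ?thesis
    by (simp only: deriv_revenue sgn_mult[of "_ / _"] sgn_pos mult_1)
qed

lemma revenue_turning_point:
  assumes "\<mu> > 0" and "\<theta> > 0"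
  obtains m where "m > 0"
    and "\<And>p. p < m \<Longrightarrow> deriv (revenue \<mu> \<theta> \<alpha>) p > 0"
    and "\<And>p. p > m \<Longrightarrow> deriv (revenue \<mu> \<theta> \<alpha>) p < 0"
proof -
  define g where "g p = 1 + exp (- (\<alpha> + \<theta> * p)) - \<theta> * p" for p
  \<comment> \<open>For nonnegative \<open>p\<close>,
    \<open>1 + exp (- (\<alpha> + \<theta> * p))\<close> is at most its value at \<open>0\<close>;
    \<open>b\<close> is where the line \<open>\<theta> * p\<close> reaches that bound, so
    \<open>g\<close> has become nonpositive there.\<close>
  define b where "b = (1 + exp (- \<alpha>)) / \<theta>"
  have g_antimono: "g y < g x" if "x < y" for x y
    using that assms unfolding g_def by (smt (verit) exp_less_mono mult_strict_left_mono)
  have g0: "g 0 > 0"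
    by (simp add: g_def add_pos_pos)
  have "b > 0"
    using assms by (simp add: b_def add_pos_pos)
  moreover have "\<theta> * b = 1 + exp (- \<alpha>)"
    using assms by (simp add: b_def)
  ultimately have "g b \<le> 0"
    using assms by (simp add: g_def order.trans[OF _ exp_ge_zero])
  moreover have "continuous_on {0..b} g"
    unfolding g_def by (intro continuous_intros)
  ultimately obtain m where m: "0 \<le> m" "g m = 0"
    using IVT2'[of g b 0 0] g0 \<open>b > 0\<close> by auto
  show thesis
  proof (rule that)
    \<comment> \<open>The intermediate value theorem gives only \<open>0 \<le> m\<close>; the
      endpoint is excluded by \<open>g 0 > 0\<close>.\<close>
    show "m > 0" using m g0 by (cases "m = 0") auto
    show "deriv (revenue \<mu> \<theta> \<alpha>) p > 0" if "p < m" for p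
      using sgn_deriv_revenue[OF assms(1), of \<theta> \<alpha> p] g_antimono[OF that] m(2)
      by (simp add: g_def sgn_1_pos)
    show "deriv (revenue \<mu> \<theta> \<alpha>) p < 0" if "p > m" for p
      using sgn_deriv_revenue[OF assms(1), of \<theta> \<alpha> p] g_antimono[OF that] m(2)
      by (simp add: g_def sgn_1_neg)
  qed
qed

theorem theorem1:
  fixes \<mu> \<theta> \<alpha> :: real
  assumes "\<mu> > 0" and "\<theta> > 0" and "\<alpha> < -2"
  shows "\<exists>p_star > 0.
    global_max_on {0..} (revenue \<mu> \<theta> \<alpha>) p_star \<and>
    (\<forall>p. 0 \<le> p \<and> p < p_star \<longrightarrow> deriv (revenue \<mu> \<theta> \<alpha>) p > 0) \<and>
    (\<forall>p > p_star. deriv (revenue \<mu> \<theta> \<alpha>) p < 0) \<and>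
    strict_mono_on {0<..<p_star} (revenue \<mu> \<theta> \<alpha>) \<and>
    strict_antimono_on {p_star<..} (revenue \<mu> \<theta> \<alpha>) \<and>
    unimodal_on {0..} (revenue \<mu> \<theta> \<alpha>)"
proof -
  let ?R = "revenue \<mu> \<theta> \<alpha>"
  obtain m where "m > 0"
    and pos: "\<And>p. p < m \<Longrightarrow> deriv ?R p > 0"
    and neg: "\<And>p. p > m \<Longrightarrow> deriv ?R p < 0"
    using revenue_turning_point[OF assms(1,2)] by blast
  have cont: "continuous_on A ?R" for A
    by (intro continuous_at_imp_continuous_on ballI DERIV_isCont[OF revenue_has_deriv])
  \<comment> \<open>The closed rays are needed so that \<open>m\<close> belongs to both pieces. The
    derivative has no strict sign at \<open>m\<close>, so the mean value argument uses its sign only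
    in the open interval between \<open>x\<close> and \<open>y\<close>, together with continuity up
    to the endpoints.\<close>
  have incr: "strict_mono_on {..m} ?R"
  proof (rule strict_mono_onI)
    fix x y assume "x \<in> {..m}" "y \<in> {..m}" "x < y"
    then show "?R x < ?R y"
      by (intro DERIV_pos_imp_increasing_open[OF _ _ cont]) (use pos revenue_has_deriv in \<open>force+\<close>)
  qed
  have decr: "strict_antimono_on {m..} ?R"
  proof (rule monotone_onI)
    fix x y assume "x \<in> {m..}" "y \<in> {m..}" "x < y"
    then show "?R x > ?R y"
      by (intro DERIV_neg_imp_decreasing_open[OF _ _ cont]) (use neg revenue_has_deriv in \<open>force+\<close>)
  qed
  have turning: "m \<in> {0..}" "strict_mono_on ({0..} \<inter> {..m}) ?R"
    "strict_antimono_on ({0..} \<inter> {m..}) ?R"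
    using \<open>m > 0\<close> by (simp_all add: monotone_on_subset[OF incr] monotone_on_subset[OF decr])
  have "strict_mono_on {0<..<m} ?R" "strict_antimono_on {m<..} ?R"
    by (rule monotone_on_subset[OF incr], force) (rule monotone_on_subset[OF decr], force)
  then show ?thesis
    using \<open>m > 0\<close> pos neg global_max_on_turning_point[OF turning]
      unimodal_on_turning_point[OF turning] by blast
qed

end
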